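(* Locally uniformly in $x,y\in\mathbb{R}$, $$\lim_{k\to\infty}E_k(x,ky)^{1/k}=e^{\sqrt{(xy)^2+1}-1}\,\frac{2}{(xy)^2}\big(\sqrt{(xy)^2+1}-1\big)$$ and $$\lim_{k\to\infty}\frac{\frac{d}{dx}E_k(x,ky)}{k\cdot E_k(x,ky)}=\frac1x\big(\sqrt{(xy)^2+1}-1\big).$$
   Context: For $k>0$ the one-dimensional Dunkl kernel is $E_k(x,y)=\frac{\Gamma(k+1/2)}{\Gamma(1/2)\Gamma(k)}\int_{-1}^1e^{xyt}(1-t)^{k-1}(1+t)^k\,dt$. The right-hand sides are understood by continuous extension where the denominators vanish (i.e. $\frac{2}{z^2}(\sqrt{z^2+1}-1)=1$ at $z=0$, and $\frac1x(\sqrt{(xy)^2+1}-1)=0$ at $x=0$). *)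

theory Defs
  imports "HOL-Analysis.Analysis"
begin

text \<open>
  The one-dimensional Dunkl kernel for real arguments; meaningful for \<open>k > 0\<close>. For \<open>k < 1\<close> the
  integrand is unbounded near \<open>t = 1\<close>, but absolutely integrable; its value at the single point
  \<open>t = 1\<close> (where \<open>0 powr (k - 1) = 0\<close>) is irrelevant.
\<close>

definition dunkl_kernel :: "real \<Rightarrow> real \<Rightarrow> real \<Rightarrow> real" where
  "dunkl_kernel k x y =
     Gamma (k + 1/2) / (Gamma (1/2) * Gamma k) *
     integral {-1..1} (\<lambda>t. exp (x * y * t) * (1 - t) powr (k - 1) * (1 + t) powr k)"

definition locally_uniform_limit ::
    "('i \<Rightarrow> 'a::topological_space \<Rightarrow> 'b::metric_space) \<Rightarrow> ('a \<Rightarrow> 'b) \<Rightarrow> 'i filter \<Rightarrow> bool" where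
  "locally_uniform_limit f l F \<longleftrightarrow> (\<forall>p. \<exists>U. open U \<and> p \<in> U \<and> uniform_limit U f l F)"

end

theory Submission
  imports Defs
begin

text \<open>
  With \<open>z = x y\<close>, the kernel \<open>E\<^sub>k(x, k y)\<close> is, up to a constant \<open>c\<^sub>k\<close>, the total mass of the positive
  weight \<open>w(t) = exp (k z t) (1 - t)\<^bsup>k - 1\<^esup> (1 + t)\<^bsup>k\<^esup>\<close> on \<open>[-1, 1]\<close>. Up to the factor \<open>1 / (1 - t)\<close> this
  is the \<open>k\<close>-th power of \<open>exp (z t) (1 - t\<^sup>2)\<close>, which has a single peak, at
  \<open>t\<^sup>* = z / (1 + sqrt (z\<^sup>2 + 1))\<close>. Write \<open>\<langle>f\<rangle>\<close> for the mean of \<open>f\<close> with respect to the normalized weight.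
  Laplace's method is replaced by one integration by parts and one application of the mean value
  theorem, so that both limits come with an explicit rate \<open>sqrt (5 / k)\<close>.

  Concentration. The function \<open>(t - t\<^sup>*) exp (k z t) (1 - t)\<^bsup>k\<^esup> (1 + t)\<^bsup>k + 1\<^esup>\<close> vanishes at both
  ends of the interval, and its derivative is \<open>w\<close> times a bounded term plus \<open>k w (t - t\<^sup>*) h(t)\<close>, where
  \<open>h(t) = z (1 - t\<^sup>2) - 2 t\<close>. As \<open>t\<^sup>*\<close> is a zero of \<open>h\<close>, the quadratic factors, and
  \<open>(t - t\<^sup>*) h(t) \<le> - (t - t\<^sup>*)\<^sup>2\<close>; hence \<open>\<langle>(t - t\<^sup>*)\<^sup>2\<rangle> \<le> 5 / k\<close> for every \<open>z\<close>
  (\<open>dunkl_second_moment_le\<close>), and \<open>\<bar>\<langle>t\<rangle> - t\<^sup>*\<bar> \<le> sqrt (5 / k)\<close> (\<open>dunkl_mean_near_peak\<close>).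

  Logarithmic derivative. Differentiating the exponential brings down \<open>k y t\<close>, so the quotient in the
  second limit is exactly \<open>y \<langle>t\<rangle>\<close> (\<open>deriv_dunkl_kernel\<close>), while its limit is \<open>y t\<^sup>*\<close>.

  Growth. As a function of \<open>z\<close>, \<open>ln E\<^sub>k / k\<close> has derivative \<open>\<langle>t\<rangle>\<close> and vanishes at \<open>z = 0\<close>; this last
  point is the normalization by \<open>c\<^sub>k\<close>, a Beta integral evaluated by Legendre's duplication formula
  (\<open>dunkl_kernel_normalized\<close>). The function
  \<open>sqrt (z\<^sup>2 + 1) - 1 - ln ((1 + sqrt (z\<^sup>2 + 1)) / 2)\<close> has derivative \<open>t\<^sup>*\<close> and also vanishes at \<open>0\<close>.
  Their difference is therefore at most \<open>sqrt (5 / k) \<bar>z\<bar>\<close> (\<open>log_dunkl_kernel_near_rate\<close>), and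
  exponentiating gives the first limit.
\<close>

definition dunkl_weight :: "real \<Rightarrow> real \<Rightarrow> real \<Rightarrow> real" where
  "dunkl_weight k z t = exp (k * z * t) * ((1 - t) powr (k - 1) * (1 + t) powr k)"

definition dunkl_moment :: "real \<Rightarrow> real \<Rightarrow> (real \<Rightarrow> real) \<Rightarrow> real" where
  "dunkl_moment k z f = integral {-1..1} (\<lambda>t. f t * dunkl_weight k z t)"

definition dunkl_mean :: "real \<Rightarrow> real \<Rightarrow> real" where
  "dunkl_mean k z = dunkl_moment k z (\<lambda>t. t) / dunkl_moment k z (\<lambda>_. 1)"

text \<open>
  The point where \<open>exp (z t) (1 - t\<^sup>2)\<close> is largest on \<open>[-1, 1]\<close>. For \<open>z \<noteq> 0\<close> it equals
  \<open>(sqrt (z\<^sup>2 + 1) - 1) / z\<close>, rationalized here so that the value at \<open>z = 0\<close> is the right one.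
\<close>

definition dunkl_peak :: "real \<Rightarrow> real" where
  "dunkl_peak z = z / (1 + sqrt (z\<^sup>2 + 1))"

text \<open>The value of \<open>z t + ln (1 - t\<^sup>2)\<close> at the peak, in a form free of division by \<open>z\<close>.\<close>

definition dunkl_rate :: "real \<Rightarrow> real" where
  "dunkl_rate z = sqrt (z\<^sup>2 + 1) - 1 - ln ((1 + sqrt (z\<^sup>2 + 1)) / 2)"

section \<open>The weight and its moments\<close>

lemma dunkl_weight_nonneg: "0 \<le> dunkl_weight k z t"
  by (simp add: dunkl_weight_def)

lemma continuous_on_dunkl_weight:
  assumes "k > 1"
  shows "continuous_on {-1..1} (dunkl_weight k z)"
  unfolding dunkl_weight_def using assms
  by (intro continuous_intros continuous_on_powr') auto

lemma integrable_dunkl_weight: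
  assumes "k > 1" "continuous_on {-1..1} f"
  shows "(\<lambda>t. f t * dunkl_weight k z t) integrable_on {-1..1}"
  by (intro integrable_continuous_real continuous_intros continuous_on_dunkl_weight assms)

lemma dunkl_moment_affine:
  assumes "k > 1" "continuous_on {-1..1} f"
  shows "dunkl_moment k z (\<lambda>t. a * f t + b)
           = a * dunkl_moment k z f + b * dunkl_moment k z (\<lambda>_. 1)"
proof -
  have "((\<lambda>t. a * (f t * dunkl_weight k z t) + b * (1 * dunkl_weight k z t)) has_integral
          a * dunkl_moment k z f + b * dunkl_moment k z (\<lambda>_. 1)) {-1..1}"
    unfolding dunkl_moment_def
    by (intro has_integral_add has_integral_mult_right integrable_integral
          integrable_dunkl_weight assms continuous_on_const)
  thus ?thesis
    by (simp add: dunkl_moment_def has_integral_iff algebra_simps)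
qed

lemma dunkl_moment_mono:
  assumes "k > 1" "continuous_on {-1..1} f" "continuous_on {-1..1} g"
    and "\<And>t. t \<in> {-1..1} \<Longrightarrow> f t \<le> g t"
  shows "dunkl_moment k z f \<le> dunkl_moment k z g"
  unfolding dunkl_moment_def
  by (intro integral_le integrable_dunkl_weight assms mult_right_mono dunkl_weight_nonneg)

lemma dunkl_moment_one_pos:
  assumes "k > 1"
  shows "0 < dunkl_moment k z (\<lambda>_. 1)"
proof -
  have "integral {-1..1} (\<lambda>_::real. 0::real) < integral {-1..1} (dunkl_weight k z)"
    by (intro integral_less_real continuous_on_dunkl_weight assms)
       (auto simp: dunkl_weight_def)
  thus ?thesis by (simp add: dunkl_moment_def)
qed

text \<open>
  For \<open>k > 1\<close> the weight is continuous up to the endpoints, which permits differentiation under the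
  integral sign.
\<close>

lemma DERIV_dunkl_moment_one:
  assumes "k > 1"
  shows "((\<lambda>z. dunkl_moment k z (\<lambda>_. 1)) has_real_derivative k * dunkl_moment k z (\<lambda>t. t)) (at z)"
proof -
  define v where "v t = (1 - t) powr (k - 1) * (1 + t) powr k" for t :: real
  have w: "dunkl_weight k z t = exp (k * z * t) * v t" for z t
    by (simp add: dunkl_weight_def v_def)
  have v: "continuous_on {-1..1} v"
    unfolding v_def using assms by (intro continuous_intros continuous_on_powr') auto
  have v': "continuous_on (UNIV \<times> {-1..1}) (\<lambda>p::real \<times> real. v (snd p))"
    by (rule continuous_on_compose2[OF v]) (auto intro: continuous_intros)
  have "((\<lambda>z. integral (cbox (-1) 1) (dunkl_weight k z)) has_real_derivative
          integral (cbox (-1) 1) (\<lambda>t. k * t * dunkl_weight k z t)) (at z within UNIV)"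
  proof (rule leibniz_rule_field_derivative)
    fix x t :: real
    show "((\<lambda>z. dunkl_weight k z t) has_real_derivative k * t * dunkl_weight k x t) (at x within UNIV)"
      unfolding w by (auto intro!: derivative_eq_intros)
    show "dunkl_weight k x integrable_on cbox (-1) 1"
      using integrable_dunkl_weight[OF assms, of "\<lambda>_. 1"] by simp
    show "continuous_on (UNIV \<times> cbox (-1) 1) (\<lambda>(x, t). k * t * dunkl_weight k x t)"
      unfolding w split_def using v' by (intro continuous_intros) auto
  qed auto
  thus ?thesis
    by (simp add: dunkl_moment_def mult.assoc)
qed

section \<open>Concentration of the weight at its peak\<close>

text \<open>
  The integrand is the derivative of \<open>(t - a) exp (k z t) (1 - t)\<^bsup>k\<^esup> (1 + t)\<^bsup>k + 1\<^esup>\<close>, one power of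
  \<open>1 - t\<close> and of \<open>1 + t\<close> above the weight; these extra factors make the boundary terms vanish.
\<close>

lemma dunkl_moment_by_parts:
  assumes "k > 1"
  shows "dunkl_moment k z
           (\<lambda>t. (1 - t\<^sup>2) + (t - a) * (1 - t) + k * ((t - a) * (z * (1 - t\<^sup>2) - 2 * t))) = 0"
proof -
  let ?F = "\<lambda>t. (t - a) * exp (k * z * t) * ((1 - t) powr k * (1 + t) powr (k + 1))"
  let ?f = "\<lambda>t. (1 - t\<^sup>2) + (t - a) * (1 - t) + k * ((t - a) * (z * (1 - t\<^sup>2) - 2 * t))"
  have "((\<lambda>t. ?f t * dunkl_weight k z t) has_integral (?F 1 - ?F (-1))) {-1..1}"
  proof (rule fundamental_theorem_of_calculus_interior)
    show "continuous_on {-1..1} ?F"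
      using assms by (intro continuous_intros continuous_on_powr') auto
    fix t :: real assume t: "t \<in> {-1<..<1}"
    have p: "(1 - t) powr k = (1 - t) * (1 - t) powr (k - 1)"
      "(1 + t) powr (k + 1) = (1 + t) * (1 + t) powr k"
      using t powr_mult_base[of "1 - t" "k - 1"] powr_mult_base[of "1 + t" k]
      by (simp_all add: add.commute)
    have "(?F has_real_derivative
        exp (k * z * t) * ((1 - t) powr k * (1 + t) powr (k + 1))
        + (t - a) * (k * z * exp (k * z * t)) * ((1 - t) powr k * (1 + t) powr (k + 1))
        + (t - a) * exp (k * z * t) * (- k * (1 - t) powr (k - 1) * (1 + t) powr (k + 1)
            + (1 - t) powr k * ((k + 1) * (1 + t) powr k))) (at t)"
      using t by (auto intro!: derivative_eq_intros simp: algebra_simps)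
    also have "exp (k * z * t) * ((1 - t) powr k * (1 + t) powr (k + 1))
        + (t - a) * (k * z * exp (k * z * t)) * ((1 - t) powr k * (1 + t) powr (k + 1))
        + (t - a) * exp (k * z * t) * (- k * (1 - t) powr (k - 1) * (1 + t) powr (k + 1)
            + (1 - t) powr k * ((k + 1) * (1 + t) powr k))
        = ?f t * dunkl_weight k z t"
      unfolding dunkl_weight_def p by (simp add: algebra_simps power2_eq_square)
    finally show "(?F has_vector_derivative ?f t * dunkl_weight k z t) (at t)"
      by (simp add: has_real_derivative_iff_has_vector_derivative)
  qed simp
  thus ?thesis
    by (simp add: dunkl_moment_def has_integral_iff)
qed

lemma abs_le_sqrt_square_plus_one: "\<bar>z\<bar> \<le> sqrt (z\<^sup>2 + 1)"
  by (rule real_le_rsqrt) simp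

text \<open>
  The quadratic on the left is \<open>1 - t\<^sup>2\<close> times the derivative of \<open>z t + ln (1 - t\<^sup>2)\<close>, so it vanishes at
  the peak. The cofactor is at least \<open>1\<close> on \<open>[-1, 1]\<close>, because \<open>\<bar>z\<bar> \<le> sqrt (z\<^sup>2 + 1)\<close>; this is what
  makes the concentration uniform in \<open>z\<close>.
\<close>

lemma dunkl_peak_factorization:
  "z * (1 - t\<^sup>2) - 2 * t = - ((1 + sqrt (z\<^sup>2 + 1) + z * t) * (t - dunkl_peak z))"
proof -
  define s where "s = sqrt (z\<^sup>2 + 1)"
  have s: "z * z = (s - 1) * (s + 1)" "s \<ge> 0"
    by (simp_all add: s_def algebra_simps flip: power2_eq_square)
  define p where "p = dunkl_peak z"
  have p: "(1 + s) * p = z"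
    using s(2) by (simp add: p_def dunkl_peak_def flip: s_def)
  have "(1 + s) * (z * p) = z * z"
    using p by (metis mult.left_commute)
  also have "\<dots> = (1 + s) * (s - 1)"
    by (simp add: s)
  finally have "z * p = s - 1"
    using s(2) by simp
  moreover have "(1 + s + z * t) * (t - p) = (1 + s) * t - (1 + s) * p + z * t\<^sup>2 - (z * p) * t"
    by (simp add: algebra_simps power2_eq_square)
  ultimately have "(1 + s + z * t) * (t - p) = (1 + s) * t - z + z * t\<^sup>2 - (s - 1) * t"
    using p by simp
  thus ?thesis
    unfolding s_def[symmetric] p_def[symmetric] by (simp add: algebra_simps)
qed

lemma abs_dunkl_peak_le_1: "\<bar>dunkl_peak z\<bar> \<le> 1"
  using abs_le_sqrt_square_plus_one[of z] by (simp add: dunkl_peak_def abs_divide)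

text \<open>
  In the integration by parts with \<open>a\<close> the peak, the term of order \<open>k\<close> is at most
  \<open>- k (t - a)\<^sup>2\<close>, and it has to balance the remaining terms, which are at most \<open>1 + 4\<close>.
\<close>

lemma dunkl_second_moment_le:
  assumes "k > 1"
  shows "dunkl_moment k z (\<lambda>t. (t - dunkl_peak z)\<^sup>2) \<le> 5 / k * dunkl_moment k z (\<lambda>_. 1)"
proof -
  let ?a = "dunkl_peak z"
  let ?h = "\<lambda>t. (1 - t\<^sup>2) + (t - ?a) * (1 - t) + k * ((t - ?a) * (z * (1 - t\<^sup>2) - 2 * t))"
  have "?h t \<le> (-k) * (t - ?a)\<^sup>2 + 5" if t: "t \<in> {-1..1}" for t
  proof -
    have "\<bar>z * t\<bar> \<le> \<bar>z\<bar> * 1"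
      unfolding abs_mult using t by (intro mult_left_mono) auto
    hence "1 \<le> 1 + sqrt (z\<^sup>2 + 1) + z * t"
      using abs_le_sqrt_square_plus_one[of z] by linarith
    hence "1 * (t - ?a)\<^sup>2 \<le> (1 + sqrt (z\<^sup>2 + 1) + z * t) * (t - ?a)\<^sup>2"
      by (intro mult_right_mono) auto
    hence "(t - ?a) * (z * (1 - t\<^sup>2) - 2 * t) \<le> - (t - ?a)\<^sup>2"
      unfolding dunkl_peak_factorization by (simp add: algebra_simps power2_eq_square)
    hence "k * ((t - ?a) * (z * (1 - t\<^sup>2) - 2 * t)) \<le> k * - (t - ?a)\<^sup>2"
      using assms by (intro mult_left_mono) auto
    also have "\<dots> = (-k) * (t - ?a)\<^sup>2" by simp
    finally have "k * ((t - ?a) * (z * (1 - t\<^sup>2) - 2 * t)) \<le> (-k) * (t - ?a)\<^sup>2" .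
    moreover have "(t - ?a) * (1 - t) \<le> 4"
    proof -
      have "(t - ?a) * (1 - t) \<le> 2 * (1 - t)"
        using t abs_dunkl_peak_le_1[of z] by (intro mult_right_mono) auto
      thus ?thesis using t by simp
    qed
    moreover have "1 - t\<^sup>2 \<le> 1" by simp
    ultimately have "?h t \<le> 1 + 4 + (-k) * (t - ?a)\<^sup>2"
      by (intro add_mono)
    thus ?thesis by simp
  qed
  hence "dunkl_moment k z ?h \<le> dunkl_moment k z (\<lambda>t. (-k) * (t - ?a)\<^sup>2 + 5)"
    by (intro dunkl_moment_mono[OF assms]) (auto intro!: continuous_intros)
  hence "0 \<le> dunkl_moment k z (\<lambda>t. (-k) * (t - ?a)\<^sup>2 + 5)"
    by (simp only: dunkl_moment_by_parts[OF assms])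
  also have "\<dots> = (-k) * dunkl_moment k z (\<lambda>t. (t - ?a)\<^sup>2) + 5 * dunkl_moment k z (\<lambda>_. 1)"
    by (intro dunkl_moment_affine assms continuous_intros)
  finally show ?thesis
    using assms by (simp add: field_simps)
qed

text \<open>
  The squared bias of the mean is at most the second moment about the peak. Integrating
  \<open>(t - a - m)\<^sup>2 \<ge> 0\<close>, with \<open>m\<close> the bias, proves this without the Cauchy--Schwarz inequality.
\<close>

lemma dunkl_mean_near_peak:
  assumes "k > 1"
  shows "\<bar>dunkl_mean k z - dunkl_peak z\<bar> \<le> sqrt (5 / k)"
proof -
  let ?a = "dunkl_peak z"
  define I where "I = dunkl_moment k z (\<lambda>_. 1)"
  have I: "I > 0"
    using dunkl_moment_one_pos[OF assms] by (simp add: I_def)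
  define m where "m = dunkl_mean k z - ?a"
  have M: "dunkl_moment k z (\<lambda>t. t) = (m + ?a) * I"
    using I by (simp add: m_def dunkl_mean_def I_def)
  have "dunkl_moment k z (\<lambda>t. 2 * m * t + - (m\<^sup>2 + 2 * m * ?a))
      \<le> dunkl_moment k z (\<lambda>t. (t - ?a)\<^sup>2)"
  proof (rule dunkl_moment_mono[OF assms])
    show "continuous_on {-1..1} (\<lambda>t. 2 * m * t + - (m\<^sup>2 + 2 * m * ?a))"
      "continuous_on {-1..1} (\<lambda>t. (t - ?a)\<^sup>2)"
      by (auto intro!: continuous_intros)
    fix t :: real
    have "0 \<le> (t - ?a - m)\<^sup>2" by simp
    thus "2 * m * t + - (m\<^sup>2 + 2 * m * ?a) \<le> (t - ?a)\<^sup>2"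
      by (simp add: power2_eq_square algebra_simps)
  qed
  also have "dunkl_moment k z (\<lambda>t. 2 * m * t + - (m\<^sup>2 + 2 * m * ?a))
      = 2 * m * ((m + ?a) * I) + - (m\<^sup>2 + 2 * m * ?a) * I"
    unfolding M[symmetric] unfolding I_def by (intro dunkl_moment_affine assms continuous_intros)
  also have "\<dots> = m\<^sup>2 * I"
    by (simp add: algebra_simps power2_eq_square)
  finally have "m\<^sup>2 * I \<le> 5 / k * I"
    using dunkl_second_moment_le[OF assms, of z] by (simp add: I_def)
  hence "m\<^sup>2 \<le> 5 / k"
    using I by (rule mult_right_le_imp_le)
  hence "\<bar>m\<bar> \<le> sqrt (5 / k)"
    using real_sqrt_le_mono by fastforce
  thus ?thesis by (simp add: m_def)
qed

section \<open>Logarithmic growth of the kernel\<close>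

text \<open>Legendre's duplication formula, transferred from the complex plane.\<close>

lemma Gamma_duplication_real:
  fixes k :: real
  assumes "k > 0"
  shows "Gamma k * Gamma (k + 1/2) = 2 powr (1 - 2 * k) * sqrt pi * Gamma (2 * k)"
proof -
  have nn: "complex_of_real r \<notin> \<int>\<^sub>\<le>\<^sub>0" if "r > 0" for r
  proof
    assume "complex_of_real r \<in> \<int>\<^sub>\<le>\<^sub>0"
    then obtain n where n: "complex_of_real r = of_int n" "n \<le> 0"
      by (elim nonpos_Ints_cases)
    hence "r = of_int n"
      by (metis of_real_of_int_eq of_real_eq_iff)
    thus False using n that by simp
  qed
  have "complex_of_real (Gamma k * Gamma (k + 1/2)) =
      Gamma (complex_of_real k) * Gamma (complex_of_real k + 1/2)"
    using Gamma_complex_of_real[of "k + 1/2"] by (simp add: Gamma_complex_of_real)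
  also have "\<dots> = exp ((1 - 2 * complex_of_real k) * of_real (ln 2)) * of_real (sqrt pi)
      * Gamma (2 * complex_of_real k)"
    using nn[of k] nn[of "k + 1/2"] assms by (intro Gamma_legendre_duplication) auto
  also have "\<dots> = complex_of_real (2 powr (1 - 2 * k) * sqrt pi * Gamma (2 * k))"
    using Gamma_complex_of_real[of "2 * k"] by (simp add: powr_def flip: exp_of_real)
  finally show ?thesis
    unfolding of_real_eq_iff .
qed

text \<open>The substitution \<open>t = 2 u - 1\<close> turns the weight with \<open>z = 0\<close> into a Beta integrand.\<close>

lemma dunkl_moment_zero_one:
  assumes "k > 1"
  shows "dunkl_moment k 0 (\<lambda>_. 1) = 2 powr (2 * k) * Beta (k + 1) k"
proof -
  have "((\<lambda>t. t powr (k + 1 - 1) * (1 - t) powr (k - 1)) has_integral Beta (k + 1) k) (cbox 0 1)"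
    using has_integral_Beta_real[of "k + 1" k] assms by simp
  from has_integral_affinity'[OF this, of "1/2" "1/2"]
  have "((\<lambda>t. (1/2 * t + 1/2) powr k * (1 - (1/2 * t + 1/2)) powr (k - 1))
      has_integral 2 * Beta (k + 1) k) {-1..1}"
    by simp
  hence "((\<lambda>t. 2 powr (2 * k - 1) * ((1/2 * t + 1/2) powr k * (1 - (1/2 * t + 1/2)) powr (k - 1)))
      has_integral 2 powr (2 * k - 1) * (2 * Beta (k + 1) k)) {-1..1}"
    by (rule has_integral_mult_right)
  hence "((\<lambda>t. 1 * dunkl_weight k 0 t) has_integral 2 powr (2 * k) * Beta (k + 1) k) {-1..1}"
  proof (rule has_integral_eq_rhs[OF has_integral_eq, rotated])
    show "2 powr (2 * k) * Beta (k + 1) k = 2 powr (2 * k - 1) * (2 * Beta (k + 1) k)"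
      by (simp add: powr_diff)
    fix t :: real assume t: "t \<in> {-1..1}"
    have "(1 + t) powr k = 2 powr k * (1/2 * t + 1/2) powr k"
      using t by (subst powr_mult[symmetric]) (auto simp: algebra_simps)
    moreover have "(1 - t) powr (k - 1) = 2 powr (k - 1) * (1 - (1/2 * t + 1/2)) powr (k - 1)"
      using t by (subst powr_mult[symmetric]) (auto simp: algebra_simps)
    moreover have "(2::real) powr (2 * k - 1) = 2 powr k * 2 powr (k - 1)"
      by (simp flip: powr_add)
    ultimately show "2 powr (2 * k - 1) * ((1/2 * t + 1/2) powr k * (1 - (1/2 * t + 1/2)) powr (k - 1))
        = 1 * dunkl_weight k 0 t"
      by (simp add: dunkl_weight_def)
  qed
  thus ?thesis
    by (simp add: dunkl_moment_def has_integral_iff)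
qed

lemma dunkl_kernel_eq_moment:
  "dunkl_kernel k x (k * y) =
     Gamma (k + 1/2) / (Gamma (1/2) * Gamma k) * dunkl_moment k (x * y) (\<lambda>_. 1)"
  by (simp add: dunkl_kernel_def dunkl_moment_def dunkl_weight_def mult_ac)

text \<open>The constant in front of the Dunkl kernel is chosen so that the kernel is \<open>1\<close> at \<open>x = 0\<close>.\<close>

lemma dunkl_kernel_normalized:
  assumes "k > 1"
  shows "Gamma (k + 1/2) / (Gamma (1/2) * Gamma k) * dunkl_moment k 0 (\<lambda>_. 1) = 1"
proof -
  have pos: "Gamma k > 0" "Gamma (2 * k) > 0" "Gamma (k + 1/2) > 0"
    using assms by (simp_all add: Gamma_real_pos)
  have B: "Beta (k + 1) k = Gamma k * Gamma k / (2 * Gamma (2 * k))"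
    using assms Gamma_plus1[of k] Gamma_plus1[of "2 * k"] pos
    by (simp add: Beta_def add_ac nonpos_Ints_def field_simps) 
  have "(2::real) powr (2 * k) * 2 powr (1 - 2 * k) = 2"
    by (simp flip: powr_add)
  hence "2 powr (2 * k) * (Gamma k * Gamma (k + 1/2)) = 2 * sqrt pi * Gamma (2 * k)"
    using assms by (simp add: Gamma_duplication_real flip: mult.assoc)
  thus ?thesis
    using pos unfolding dunkl_moment_zero_one[OF assms] B Gamma_one_half_real
    by (simp add: field_simps)
qed

lemma dunkl_kernel_pos:
  assumes "k > 1"
  shows "0 < dunkl_kernel k x (k * y)"
  unfolding dunkl_kernel_eq_moment Gamma_one_half_real
  using assms by (intro mult_pos_pos divide_pos_pos dunkl_moment_one_pos Gamma_real_pos) auto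

lemma DERIV_dunkl_rate: "(dunkl_rate has_real_derivative dunkl_peak z) (at z)"
proof -
  define s where "s = sqrt (z\<^sup>2 + 1)"
  have pos: "z\<^sup>2 + 1 > 0"
    by (simp add: add_nonneg_pos)
  hence s: "s > 0"
    by (simp add: s_def)
  have "(dunkl_rate has_real_derivative z / s - (z / s) / (1 + s)) (at z)"
    unfolding dunkl_rate_def using pos s
    by (auto intro!: derivative_eq_intros simp: s_def add_pos_pos field_simps)
  also have "z / s - (z / s) / (1 + s) = dunkl_peak z"
  proof -
    have "1 + s \<noteq> 0" using s by simp
    moreover have "z / s - (z / s) / (1 + s) = (z / s) * (1 - 1 / (1 + s))"
      by (simp add: right_diff_distrib)
    moreover have "1 - 1 / (1 + s) = s / (1 + s)"
      using \<open>1 + s \<noteq> 0\<close> by (simp add: diff_divide_eq_iff)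
    ultimately show ?thesis
      using s by (simp add: dunkl_peak_def flip: s_def)
  qed
  finally show ?thesis .
qed

text \<open>
  Both functions of \<open>z\<close> vanish at \<open>0\<close>, and their derivatives, the mean and the peak, are within
  \<open>sqrt (5 / k)\<close> of each other everywhere.
\<close>

lemma log_dunkl_kernel_near_rate:
  assumes "k > 1"
  shows "\<bar>ln (dunkl_kernel k x (k * y)) / k - dunkl_rate (x * y)\<bar> \<le> sqrt (5 / k) * \<bar>x * y\<bar>"
proof -
  define C where "C = Gamma (k + 1/2) / (Gamma (1/2) * Gamma k)"
  have C: "C > 0"
    unfolding C_def Gamma_one_half_real
    using assms by (intro mult_pos_pos divide_pos_pos Gamma_real_pos) auto
  define D where "D z = ln (C * dunkl_moment k z (\<lambda>_. 1)) / k - dunkl_rate z" for z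
  have "norm (D (x * y) - D 0) \<le> sqrt (5 / k) * norm (x * y - 0)"
  proof (rule field_differentiable_bound)
    fix z :: real
    show "(D has_real_derivative dunkl_mean k z - dunkl_peak z) (at z within UNIV)"
      unfolding D_def using C dunkl_moment_one_pos[OF assms, of z] assms
      by (auto intro!: derivative_eq_intros DERIV_dunkl_moment_one DERIV_dunkl_rate
               simp: dunkl_mean_def)
    show "norm (dunkl_mean k z - dunkl_peak z) \<le> sqrt (5 / k)"
      using dunkl_mean_near_peak[OF assms] by simp
  qed auto
  moreover have "D 0 = 0"
    using dunkl_kernel_normalized[OF assms] by (simp add: D_def C_def dunkl_rate_def)
  ultimately show ?thesis
    by (simp add: D_def C_def dunkl_kernel_eq_moment)
qed

section \<open>The two limits\<close>

lemma deriv_dunkl_kernel: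
  assumes "k > 1"
  shows "deriv (\<lambda>u. dunkl_kernel k u (k * y)) x / (k * dunkl_kernel k x (k * y))
           = y * dunkl_mean k (x * y)"
proof -
  define C where "C = Gamma (k + 1/2) / (Gamma (1/2) * Gamma k)"
  have C: "C > 0"
    unfolding C_def Gamma_one_half_real
    using assms by (intro mult_pos_pos divide_pos_pos Gamma_real_pos) auto
  have "((\<lambda>u. dunkl_moment k (u * y) (\<lambda>_. 1)) has_real_derivative
      k * dunkl_moment k (x * y) (\<lambda>t. t) * y) (at x)"
    by (rule DERIV_chain2[OF DERIV_dunkl_moment_one[OF assms]]) (auto intro!: derivative_eq_intros)
  hence "((\<lambda>u. dunkl_kernel k u (k * y)) has_real_derivative
      C * (k * dunkl_moment k (x * y) (\<lambda>t. t) * y)) (at x)"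
    unfolding dunkl_kernel_eq_moment C_def[symmetric] by (rule DERIV_cmult)
  thus ?thesis
    using C assms by (simp add: DERIV_imp_deriv dunkl_kernel_eq_moment dunkl_mean_def flip: C_def)
qed

lemma exp_dunkl_rate:
  "exp (dunkl_rate z) =
     exp (sqrt (z\<^sup>2 + 1) - 1) * (if z = 0 then 1 else 2 / z\<^sup>2 * (sqrt (z\<^sup>2 + 1) - 1))"
proof -
  define s where "s = sqrt (z\<^sup>2 + 1)"
  have s: "z\<^sup>2 = (s - 1) * (s + 1)" "s \<ge> 0"
    by (simp_all add: s_def algebra_simps flip: power2_eq_square)
  have "(if z = 0 then 1 else 2 / z\<^sup>2 * (s - 1)) = 2 / (1 + s)"
  proof (cases "z = 0")
    case False
    hence "s - 1 \<noteq> 0" using s by auto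
    moreover have "s + 1 \<noteq> 0" using s by auto
    ultimately have "2 / z\<^sup>2 * (s - 1) = 2 / (s + 1)"
      unfolding s(1) mult.commute[of "s - 1" "s + 1"] times_divide_eq_left
      by (intro mult_divide_mult_cancel_right)
    thus ?thesis using False by (simp add: add.commute)
  qed (simp add: s_def)
  moreover have "exp (dunkl_rate z) = exp (s - 1) * (2 / (1 + s))"
    using s(2) by (simp add: dunkl_rate_def exp_diff flip: s_def)
  ultimately show ?thesis
    unfolding s_def[symmetric] by (simp only:)
qed

lemma mult_dunkl_peak:
  "y * dunkl_peak (x * y) = (if x = 0 then 0 else 1 / x * (sqrt ((x * y)\<^sup>2 + 1) - 1))"
proof -
  define s where "s = sqrt ((x * y)\<^sup>2 + 1)"
  have s: "(x * y)\<^sup>2 = (s - 1) * (s + 1)" "s \<ge> 0"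
    by (simp_all add: s_def algebra_simps flip: power2_eq_square)
  have "y * (x * y / (1 + s)) = 1 / x * (s - 1)" if "x \<noteq> 0"
  proof -
    have "y * (x * y / (1 + s)) = (x * y)\<^sup>2 / ((1 + s) * x)"
      using that by (simp add: power2_eq_square)
    also have "\<dots> = 1 / x * (s - 1)"
      unfolding s(1) using s(2) that by (simp add: add.commute)
    finally show ?thesis .
  qed
  thus ?thesis
    unfolding dunkl_peak_def s_def[symmetric] by simp
qed

lemma abs_exp_diff_le:
  fixes a b :: real
  assumes "a \<le> B" "b \<le> B"
  shows "\<bar>exp a - exp b\<bar> \<le> exp B * \<bar>a - b\<bar>"
proof -
  have "norm (exp a - exp b) \<le> exp B * norm (a - b)"
    by (rule field_differentiable_bound[of "{..B}" exp exp])
       (use assms in \<open>auto intro!: derivative_eq_intros\<close>)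
  thus ?thesis by simp
qed

text \<open>
  The unit ball around a point lies in a square \<open>[-M, M]\<^sup>2\<close>, so a bound on each such square suffices. The
  rate \<open>sqrt (5 / k)\<close> is the one provided by the concentration of the weight.
\<close>

lemma locally_uniform_limitI:
  fixes f :: "real \<Rightarrow> real \<times> real \<Rightarrow> real"
  assumes "\<And>M. M \<ge> 0 \<Longrightarrow> \<exists>C. \<forall>\<^sub>F k in at_top. \<forall>x y. \<bar>x\<bar> \<le> M \<longrightarrow> \<bar>y\<bar> \<le> M \<longrightarrow>
             \<bar>f k (x, y) - l (x, y)\<bar> \<le> C * sqrt (5 / k)"
  shows "locally_uniform_limit f l at_top"
  unfolding locally_uniform_limit_def
proof
  fix p :: "real \<times> real"
  define M where "M = norm p + 1"
  obtain C where C: "\<forall>\<^sub>F k in at_top. \<forall>x y. \<bar>x\<bar> \<le> M \<longrightarrow> \<bar>y\<bar> \<le> M \<longrightarrow>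
             \<bar>f k (x, y) - l (x, y)\<bar> \<le> C * sqrt (5 / k)"
    using assms[of M] by (auto simp: M_def)
  have bd: "\<bar>fst q\<bar> \<le> M \<and> \<bar>snd q\<bar> \<le> M" if "q \<in> ball p 1" for q
  proof -
    have "norm q \<le> norm p + norm (q - p)"
      by (rule norm_triangle_sub)
    hence "norm q \<le> M"
      using that by (simp add: M_def dist_norm norm_minus_commute)
    thus ?thesis
      using norm_fst_le[of "fst q" "snd q"] norm_snd_le[of "snd q" "fst q"] by auto
  qed
  have "uniform_limit (ball p 1) f l at_top"
  proof (rule uniform_limitI)
    fix e :: real assume "e > 0"
    have "((\<lambda>k. C * sqrt (5 / k)) \<longlongrightarrow> C * sqrt 0) at_top"
      by (intro tendsto_intros tendsto_divide_0 filterlim_at_top_imp_at_infinity filterlim_ident) auto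
    hence "\<forall>\<^sub>F k in at_top. C * sqrt (5 / k) < e"
      using \<open>e > 0\<close> by (auto intro: order_tendstoD)
    with C show "\<forall>\<^sub>F k in at_top. \<forall>q\<in>ball p 1. dist (f k q) (l q) < e"
    proof eventually_elim
      case (elim k)
      show ?case
      proof
        fix q assume "q \<in> ball p 1"
        hence "\<bar>f k (fst q, snd q) - l (fst q, snd q)\<bar> \<le> C * sqrt (5 / k)"
          using bd elim(1) by blast
        thus "dist (f k q) (l q) < e"
          using elim(2) by (simp add: dist_real_def)
      qed
    qed
  qed
  thus "\<exists>U. open U \<and> p \<in> U \<and> uniform_limit U f l at_top"
    by (intro exI[of _ "ball p 1"]) auto
qed

theorem proposition6p1:
  shows "locally_uniform_limit
           (\<lambda>(k::real) (x::real, y::real). dunkl_kernel k x (k * y) powr (1 / k))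
           (\<lambda>(x, y). exp (sqrt ((x * y)^2 + 1) - 1) *
                     (if x * y = 0 then 1 else 2 / (x * y)^2 * (sqrt ((x * y)^2 + 1) - 1)))
           at_top
       \<and> locally_uniform_limit
           (\<lambda>(k::real) (x::real, y::real).
              deriv (\<lambda>u. dunkl_kernel k u (k * y)) x / (k * dunkl_kernel k x (k * y)))
           (\<lambda>(x, y). if x = 0 then 0 else 1 / x * (sqrt ((x * y)^2 + 1) - 1))
           at_top"
proof (intro conjI locally_uniform_limitI; unfold case_prod_conv)
  fix M :: real
  \<comment> \<open>The limiting exponent is at most \<open>\<bar>x y\<bar> \<le> M\<^sup>2\<close>, and for \<open>k \<ge> 5\<close> the exponent
    \<open>ln E\<^sub>k / k\<close> is within \<open>sqrt (5 / k) M\<^sup>2 \<le> M\<^sup>2\<close> of it; hence both are at most \<open>2 M\<^sup>2\<close>, and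
    \<open>exp\<close> is Lipschitz there.\<close>
  have "\<forall>\<^sub>F k in at_top. \<forall>x y. \<bar>x\<bar> \<le> M \<longrightarrow> \<bar>y\<bar> \<le> M \<longrightarrow>
      \<bar>dunkl_kernel k x (k * y) powr (1 / k) - exp (dunkl_rate (x * y))\<bar>
        \<le> (exp (2 * M\<^sup>2) * M\<^sup>2) * sqrt (5 / k)"
    using eventually_ge_at_top[of 5]
  proof eventually_elim
    case (elim k)
    show ?case
    proof (intro allI impI)
      fix x y :: real assume xy: "\<bar>x\<bar> \<le> M" "\<bar>y\<bar> \<le> M"
      define a where "a = ln (dunkl_kernel k x (k * y)) / k"
      have z: "\<bar>x * y\<bar> \<le> M\<^sup>2"
        unfolding abs_mult power2_eq_square using xy by (intro mult_mono) auto
      have near: "\<bar>a - dunkl_rate (x * y)\<bar> \<le> sqrt (5 / k) * \<bar>x * y\<bar>"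
        using log_dunkl_kernel_near_rate[of k x y] elim by (simp add: a_def)
      also have "\<dots> \<le> sqrt (5 / k) * M\<^sup>2"
        using z elim by (intro mult_left_mono) auto
      finally have near': "\<bar>a - dunkl_rate (x * y)\<bar> \<le> sqrt (5 / k) * M\<^sup>2" .
      also have "\<dots> \<le> 1 * M\<^sup>2"
        using elim by (intro mult_right_mono) auto
      finally have close: "\<bar>a - dunkl_rate (x * y)\<bar> \<le> M\<^sup>2" by simp
      have "sqrt ((x * y)\<^sup>2 + 1) \<le> \<bar>x * y\<bar> + 1"
        using sqrt_add_le_add_sqrt[of "(x * y)\<^sup>2" 1] by simp
      moreover have "ln ((1 + sqrt ((x * y)\<^sup>2 + 1)) / 2) \<ge> 0"
        by (intro ln_ge_zero) simp
      ultimately have rate: "dunkl_rate (x * y) \<le> M\<^sup>2"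
        unfolding dunkl_rate_def using z by linarith
      have "dunkl_kernel k x (k * y) powr (1 / k) = exp a"
        using dunkl_kernel_pos[of k x y] elim by (simp add: powr_def a_def)
      hence "\<bar>dunkl_kernel k x (k * y) powr (1 / k) - exp (dunkl_rate (x * y))\<bar>
          \<le> exp (2 * M\<^sup>2) * \<bar>a - dunkl_rate (x * y)\<bar>"
        using abs_exp_diff_le[of a "2 * M\<^sup>2" "dunkl_rate (x * y)"] rate close by simp
      also have "\<dots> \<le> exp (2 * M\<^sup>2) * (sqrt (5 / k) * M\<^sup>2)"
        using near' by (intro mult_left_mono) auto
      finally show "\<bar>dunkl_kernel k x (k * y) powr (1 / k) - exp (dunkl_rate (x * y))\<bar>
          \<le> (exp (2 * M\<^sup>2) * M\<^sup>2) * sqrt (5 / k)"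
        by (simp add: mult_ac)
    qed
  qed
  thus "\<exists>C. \<forall>\<^sub>F k in at_top. \<forall>x y. \<bar>x\<bar> \<le> M \<longrightarrow> \<bar>y\<bar> \<le> M \<longrightarrow>
      \<bar>dunkl_kernel k x (k * y) powr (1 / k) - exp (sqrt ((x * y)\<^sup>2 + 1) - 1) *
        (if x * y = 0 then 1 else 2 / (x * y)\<^sup>2 * (sqrt ((x * y)\<^sup>2 + 1) - 1))\<bar>
        \<le> C * sqrt (5 / k)"
    unfolding exp_dunkl_rate by (intro exI)
next
  fix M :: real assume M: "M \<ge> 0"
  have "\<forall>\<^sub>F k in at_top. \<forall>x y. \<bar>x\<bar> \<le> M \<longrightarrow> \<bar>y\<bar> \<le> M \<longrightarrow>
      \<bar>deriv (\<lambda>u. dunkl_kernel k u (k * y)) x / (k * dunkl_kernel k x (k * y))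
        - y * dunkl_peak (x * y)\<bar> \<le> M * sqrt (5 / k)"
    using eventually_gt_at_top[of 1]
  proof eventually_elim
    case (elim k)
    show ?case
    proof (intro allI impI)
      fix x y :: real assume "\<bar>y\<bar> \<le> M"
      thus "\<bar>deriv (\<lambda>u. dunkl_kernel k u (k * y)) x / (k * dunkl_kernel k x (k * y))
          - y * dunkl_peak (x * y)\<bar> \<le> M * sqrt (5 / k)"
        unfolding deriv_dunkl_kernel[OF elim] right_diff_distrib[symmetric] abs_mult
        by (intro mult_mono dunkl_mean_near_peak elim M) auto
    qed
  qed
  thus "\<exists>C. \<forall>\<^sub>F k in at_top. \<forall>x y. \<bar>x\<bar> \<le> M \<longrightarrow> \<bar>y\<bar> \<le> M \<longrightarrow>
      \<bar>deriv (\<lambda>u. dunkl_kernel k u (k * y)) x / (k * dunkl_kernel k x (k * y))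
        - (if x = 0 then 0 else 1 / x * (sqrt ((x * y)\<^sup>2 + 1) - 1))\<bar> \<le> C * sqrt (5 / k)"
    unfolding mult_dunkl_peak by (intro exI)
qed

end
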